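(* Let $f=\sum_{i=0}^\infty a_i z^i\in \mathbb{Z}[[z]]$ be such that $a_0=\pm p^k$ for some positive integer $k\geq 2$ and a prime $p$. Suppose there exists an index $j\geq 1$ for which $p^k$ divides $\gcd(a_1,\ldots,a_{j-1})$ and $p$ does not divide $a_j$. If $\gcd(k,j)=1$, then $f$ is irreducible in $\mathbb{Z}[[z]]$.
   Context: $\mathbb{Z}[[z]]$ denotes the ring of formal power series in $z$ over $\mathbb{Z}$. The condition that $p^k$ divides $\gcd(a_1,\ldots,a_{j-1})$ means that $p^k$ divides each of $a_1,\ldots,a_{j-1}$ (so it is vacuous when $j=1$). *)

theory Defs
  imports "HOL-Computational_Algebra.Computational_Algebra"
begin

end

theory Submission
  imports Defs
begin

text \<open>
  The proof is the Newton polygon argument, reduced to a single comparison of weights.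
  Give the term \<open>a z ^ i\<close> with \<open>a \<noteq> 0\<close> the weight \<open>j * v a + k * i\<close>, where \<open>v\<close> is the \<open>p\<close>-adic
  valuation. This is the weight for which the two corners \<open>(0, k)\<close> and \<open>(j, 0)\<close> of the
  Newton polygon of \<open>f\<close> are equally heavy, and the hypotheses say that no term of \<open>f\<close> is lighter
  than \<open>j * k\<close>. On the other hand the lightest terms of two factors survive in their product
  (Gauss's lemma), so the weight of any term of \<open>g\<close> plus the weight of any term of
  \<open>h\<close> is bounded below by the weight of some term of \<open>g * h\<close>
  (\<open>fps_mult_term_weight_le\<close>).

  Suppose \<open>f = g * h\<close> with neither factor a unit. Then the constant coefficients have valuations
  \<open>r, s \<ge> 1\<close> with \<open>r + s = k\<close>. As \<open>p\<close> does not divide the coefficient of \<open>z ^ j\<close> in \<open>f\<close>, there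
  are indices \<open>u + v = j\<close> such that \<open>p\<close> divides neither the coefficient of \<open>z ^ u\<close> in \<open>g\<close> nor that
  of \<open>z ^ v\<close> in \<open>h\<close>, and \<open>u, v \<ge> 1\<close> because \<open>p\<close> divides both constant coefficients. Pairing the
  constant term of one factor with the other of these two terms gives
  \<open>j * r + k * v \<ge> j * k\<close> and \<open>j * s + k * u \<ge> j * k\<close>. The left-hand sides add up to
  \<open>2 * j * k\<close>, so both are equalities. Hence \<open>j\<close> divides \<open>k * v\<close>, and by coprimality it
  divides \<open>v\<close>, contradicting \<open>0 < v < j\<close>.
\<close>

lemma fps_dvd_one_iff:
  fixes f :: "'a :: comm_ring_1 fps"
  shows "f dvd 1 \<longleftrightarrow> fps_nth f 0 dvd 1"
proof
  assume "f dvd 1"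
  then obtain g where "1 = f * g" by (elim dvdE)
  hence "1 = fps_nth f 0 * fps_nth g 0"
    by (metis fps_mult_nth_0 fps_one_nth)
  thus "fps_nth f 0 dvd 1" by (rule dvdI)
next
  assume "fps_nth f 0 dvd 1"
  then obtain y where "1 = fps_nth f 0 * y" by (elim dvdE)
  hence "f * fps_right_inverse f y = 1"
    by (intro fps_right_inverse) simp
  thus "f dvd 1" by (metis dvd_triv_left)
qed

definition term_weight ::
    "'a :: factorial_semiring \<Rightarrow> nat \<Rightarrow> nat \<Rightarrow> 'a fps \<Rightarrow> nat \<Rightarrow> nat" where
  "term_weight p a b f i = a * multiplicity p (fps_nth f i) + b * i"

lemma first_lightest_term:
  fixes g :: "'a :: factorial_semiring fps"
  assumes "g \<noteq> 0"
  obtains i where "fps_nth g i \<noteq> 0"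
    and "\<And>l. fps_nth g l \<noteq> 0 \<Longrightarrow> term_weight p a b g i \<le> term_weight p a b g l"
    and "\<And>l. fps_nth g l \<noteq> 0 \<Longrightarrow> l < i \<Longrightarrow> term_weight p a b g i < term_weight p a b g l"
proof -
  let ?W = "term_weight p a b g"
  from assms obtain i0 where "fps_nth g i0 \<noteq> 0"
    by (auto simp: fps_eq_iff)
  then obtain m where m: "fps_nth g m \<noteq> 0" "\<And>l. fps_nth g l \<noteq> 0 \<Longrightarrow> ?W m \<le> ?W l"
    using ex_has_least_nat[of "\<lambda>i. fps_nth g i \<noteq> 0" i0 ?W] by auto
  define P where "P i \<longleftrightarrow> fps_nth g i \<noteq> 0 \<and> ?W i = ?W m" for i
  have P: "P (Least P)" by (rule LeastI[of P m]) (simp add: P_def m)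
  show thesis
  proof
    show "fps_nth g (Least P) \<noteq> 0" using P by (simp add: P_def)
    show "?W (Least P) \<le> ?W l" if "fps_nth g l \<noteq> 0" for l
      using P m(2)[OF that] by (simp add: P_def)
    show "?W (Least P) < ?W l" if "fps_nth g l \<noteq> 0" "l < Least P" for l
      using P m(2)[OF that(1)] not_less_Least[OF that(2)] that(1)
      by (simp add: P_def)
  qed
qed

text \<open>
  This is the half of Gauss's lemma for weighted valuations that forbids cancellation. If
  \<open>i\<close> and \<open>l\<close> are the first positions of minimal weight in the two factors, then in the sum for the
  coefficient of \<open>z ^ (i + l)\<close> in the product every other summand has one factor at a position
  that comes too early to be lightest. As all summands share the contribution \<open>b * (i + l)\<close>,
  the others have strictly larger valuation, and they cannot cancel the summand from \<open>i\<close> and \<open>l\<close>.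
\<close>

lemma fps_mult_term_weight_le:
  fixes g h :: "'a :: {factorial_semiring, idom} fps"
  assumes p: "prime_elem p" and "a > 0"
    and gx: "fps_nth g x \<noteq> 0" and hy: "fps_nth h y \<noteq> 0"
  obtains t where "fps_nth (g * h) t \<noteq> 0"
    and "term_weight p a b (g * h) t \<le> term_weight p a b g x + term_weight p a b h y"
proof -
  let ?W = "term_weight p a b"
  have "g \<noteq> 0" "h \<noteq> 0" using gx hy by auto
  obtain i where i: "fps_nth g i \<noteq> 0"
    and i_le: "\<And>l. fps_nth g l \<noteq> 0 \<Longrightarrow> ?W g i \<le> ?W g l"
    and i_less: "\<And>l. fps_nth g l \<noteq> 0 \<Longrightarrow> l < i \<Longrightarrow> ?W g i < ?W g l"
    using first_lightest_term[OF \<open>g \<noteq> 0\<close>] by metis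
  obtain l where l: "fps_nth h l \<noteq> 0"
    and l_le: "\<And>i. fps_nth h i \<noteq> 0 \<Longrightarrow> ?W h l \<le> ?W h i"
    and l_less: "\<And>i. fps_nth h i \<noteq> 0 \<Longrightarrow> i < l \<Longrightarrow> ?W h l < ?W h i"
    using first_lightest_term[OF \<open>h \<noteq> 0\<close>] by metis
  define e where "e = multiplicity p (fps_nth g i) + multiplicity p (fps_nth h l)"
  have "\<not> is_unit p" using p by (simp add: prime_elem_def)
  have power_dvd_mult_iff:
    "p ^ n dvd c * d \<longleftrightarrow> n \<le> multiplicity p c + multiplicity p d"
    if "c \<noteq> 0" "d \<noteq> 0" for n c d
    using that p \<open>\<not> is_unit p\<close>
    by (simp add: power_dvd_iff_le_multiplicity prime_elem_multiplicity_mult_distrib)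
  have other: "p ^ Suc e dvd fps_nth g c * fps_nth h (i + l - c)"
    if c: "c \<in> {0..i + l} - {i}" for c
  proof (cases "fps_nth g c = 0 \<or> fps_nth h (i + l - c) = 0")
    case False
    hence nz: "fps_nth g c \<noteq> 0" "fps_nth h (i + l - c) \<noteq> 0" by auto
    have "?W g i + ?W h l < ?W g c + ?W h (i + l - c)"
    proof (cases "c < i")
      case True
      thus ?thesis using i_less[OF nz(1)] l_le[OF nz(2)] by linarith
    next
      case False
      hence "i + l - c < l" using c by auto
      thus ?thesis using i_le[OF nz(1)] l_less[OF nz(2)] by linarith
    qed
    moreover have "b * c + b * (i + l - c) = b * i + b * l"
      using c by (simp flip: add_mult_distrib2)
    ultimately have "a * e < a * (multiplicity p (fps_nth g c) +
        multiplicity p (fps_nth h (i + l - c)))"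
      by (simp add: term_weight_def e_def add_mult_distrib2)
    thus ?thesis
      unfolding power_dvd_mult_iff[OF nz] by simp
  qed auto
  have "fps_nth (g * h) (i + l) =
      fps_nth g i * fps_nth h l + (\<Sum>c\<in>{0..i + l} - {i}. fps_nth g c * fps_nth h (i + l - c))"
    by (simp add: fps_mult_nth sum.remove[of _ i])
  moreover have "p ^ Suc e dvd (\<Sum>c\<in>{0..i + l} - {i}. fps_nth g c * fps_nth h (i + l - c))"
    by (intro dvd_sum other)
  moreover have "\<not> p ^ Suc e dvd fps_nth g i * fps_nth h l"
    unfolding power_dvd_mult_iff[OF i l] by (simp add: e_def)
  ultimately have not_dvd: "\<not> p ^ Suc e dvd fps_nth (g * h) (i + l)"
    by (simp add: dvd_add_left_iff del: power_Suc)
  show thesis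
  proof
    show "fps_nth (g * h) (i + l) \<noteq> 0"
      using not_dvd by (metis dvd_0_right)
    hence "multiplicity p (fps_nth (g * h) (i + l)) < Suc e"
      using not_dvd \<open>\<not> is_unit p\<close> by (intro multiplicity_lessI)
    hence "?W (g * h) (i + l) \<le> a * e + b * (i + l)"
      by (simp add: term_weight_def)
    also have "\<dots> = ?W g i + ?W h l"
      by (simp add: term_weight_def e_def algebra_simps)
    also have "\<dots> \<le> ?W g x + ?W h y"
      by (intro add_mono i_le l_le gx hy)
    finally show "?W (g * h) (i + l) \<le> ?W g x + ?W h y" .
  qed
qed

theorem theorem6:
  fixes f :: "int fps" and p k j :: nat
  assumes "prime p" and "k \<ge> 2"
    and "fps_nth f 0 = int p ^ k \<or> fps_nth f 0 = - (int p ^ k)"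
    and "j \<ge> 1"
    and "\<forall>i\<in>{1..<j}. int p ^ k dvd fps_nth f i"
    and "\<not> int p dvd fps_nth f j"
    and "coprime k j"
  shows "irreducible f"
proof -
  let ?v = "multiplicity (int p)"
  let ?W = "term_weight (int p) j k"
  have prime: "prime (int p)" using assms(1) by simp
  hence prime_elem: "prime_elem (int p)" by (rule prime_imp_prime_elem)
  have non_unit: "\<not> is_unit (int p)" using prime_elem by (blast dest: prime_elem_not_unit)
  have p0: "int p \<noteq> 0" using prime by auto
  have v_power: "?v (fps_nth f 0) = k"
    using assms(3) p0 non_unit by (auto simp: multiplicity_same_power)
  have f0: "fps_nth f 0 \<noteq> 0" using assms(3) p0 by auto
  have unit_iff: "is_unit c \<longleftrightarrow> \<not> int p dvd c" if "c dvd fps_nth f 0" for c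
  proof -
    have "c dvd int p ^ k" using that assms(3) by auto
    then obtain m where "normalize c = int p ^ m"
      using divides_primepow[OF prime] by blast
    hence "is_unit c \<longleftrightarrow> is_unit (int p ^ m)" "int p dvd c \<longleftrightarrow> int p dvd int p ^ m"
      by (metis normalize_dvd_iff dvd_normalize_iff)+
    moreover have "is_unit (int p ^ m) \<longleftrightarrow> m = 0"
      using non_unit by (simp only: is_unit_power_iff) simp
    moreover have "int p dvd int p ^ m \<longleftrightarrow> m \<noteq> 0"
      using non_unit by (cases m) simp_all
    ultimately show ?thesis by simp
  qed

  have weight_ge: "j * k \<le> ?W f t" if "fps_nth f t \<noteq> 0" for t
  proof -
    consider "t = 0" | "t \<in> {1..<j}" | "t \<ge> j" by fastforce
    thus ?thesis
    proof cases
      case 1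
      thus ?thesis by (simp add: term_weight_def v_power)
    next
      case 2
      hence "k \<le> ?v (fps_nth f t)"
        using assms(5) that non_unit by (intro multiplicity_geI) auto
      hence "j * k \<le> j * ?v (fps_nth f t)" by (rule mult_le_mono2)
      thus ?thesis by (simp add: term_weight_def trans_le_add1 del: mult_le_cancel1)
    next
      case 3
      hence "j * k \<le> k * t" by (simp add: mult.commute)
      thus ?thesis by (simp add: term_weight_def trans_le_add2)
    qed
  qed

  show ?thesis
  proof (rule irreducibleI)
    show "f \<noteq> 0" using f0 by auto
    have "int p dvd fps_nth f 0" using assms(2,3) by (auto intro: dvd_power)
    thus "\<not> f dvd 1" using unit_iff[of "fps_nth f 0"] by (simp add: fps_dvd_one_iff)
  next
    fix g h assume f: "f = g * h"
    show "g dvd 1 \<or> h dvd 1"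
    proof (rule ccontr)
      assume "\<not> (g dvd 1 \<or> h dvd 1)"
      hence p_dvd: "int p dvd fps_nth g 0" "int p dvd fps_nth h 0"
        using unit_iff[of "fps_nth g 0"] unit_iff[of "fps_nth h 0"]
        by (auto simp: fps_dvd_one_iff f)
      have nz0: "fps_nth g 0 \<noteq> 0" "fps_nth h 0 \<noteq> 0" using f0 by (auto simp: f)
      have rs: "?v (fps_nth g 0) + ?v (fps_nth h 0) = k"
        using v_power prime_elem_multiplicity_mult_distrib[OF prime_elem nz0] by (simp add: f)
      have "\<exists>u\<in>{0..j}. \<not> int p dvd fps_nth g u * fps_nth h (j - u)"
        using assms(6) unfolding f fps_mult_nth by (meson dvd_sum)
      then obtain u where u: "u \<le> j" "\<not> int p dvd fps_nth g u" "\<not> int p dvd fps_nth h (j - u)"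
        by (metis atLeastAtMost_iff dvd_mult dvd_mult2)
      have bounds: "u \<noteq> 0" "u \<noteq> j"
        using u(2,3) p_dvd by (metis, metis diff_self_eq_0)
      have nz: "fps_nth g u \<noteq> 0" "fps_nth h (j - u) \<noteq> 0" using u(2,3) by auto
      have pair: "j * k \<le> ?W g x + ?W h y" if "fps_nth g x \<noteq> 0" "fps_nth h y \<noteq> 0" for x y
        using fps_mult_term_weight_le[OF prime_elem _ that, of j k] assms(4) weight_ge
        unfolding f by (metis One_nat_def Suc_le_lessD le_trans)
      define r s where "r = ?v (fps_nth g 0)" and "s = ?v (fps_nth h 0)"
      have 1: "j * k \<le> j * r + k * (j - u)"
        using pair[OF nz0(1) nz(2)] u(3)
        by (simp add: term_weight_def r_def not_dvd_imp_multiplicity_0)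
      have 2: "j * k \<le> k * u + j * s"
        using pair[OF nz(1) nz0(2)] u(2)
        by (simp add: term_weight_def s_def not_dvd_imp_multiplicity_0)
      have "k * (j - u) + k * u = j * k" "j * r + j * s = j * k"
        using u(1) rs by (simp_all add: r_def s_def mult.commute flip: add_mult_distrib2)
      with 1 2 have "j * s = k * (j - u)" by linarith
      hence "j dvd k * (j - u)" by (metis dvd_triv_left)
      hence "j dvd j - u"
        using assms(7) by (simp add: coprime_dvd_mult_right_iff coprime_commute)
      thus False using bounds u(1) by (auto dest: dvd_imp_le)
    qed
  qed
qed

end
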